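(* Let $n,m\ge2$. Let $\le$ be a partial order on $DO(nm)$ such that each $\rho\in DO(nm)$ is below the pure state corresponding to its highest eigenvalue, i.e. $\rho\le|v\rangle\langle v|$ for every unit vector $v$ in the eigenspace of the highest eigenvalue of $\rho$. Let $\le'$ be a partial order on $DO(n)$ for which the completely mixed state $\bot_n=\frac1nI_n$ is the bottom element. Then the partial trace $\operatorname{tr}_2:M_{nm}\to M_n$ does not restrict to a monotone map $(DO(nm),\le)\to(DO(n),\le')$.
   Context: $M_n$ denotes the complex $n\times n$ matrices and $DO(n)=\{A\in M_n : A\ge 0,\ \operatorname{tr}A=1\}$ is the set of states. $M_{nm}$ is identified with $M_n\otimes M_m$, and $\operatorname{tr}_2$ is the partial trace over the second tensor factor, $\operatorname{tr}_2(A\otimes B)=\operatorname{tr}(B)A$ extended linearly. *)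

theory Defs
  imports "Jordan_Normal_Form.Spectral_Radius" "Jordan_Normal_Form.Schur_Decomposition"
begin

definition mat_trace :: "complex mat \<Rightarrow> complex" where
  "mat_trace A = (\<Sum>i<dim_row A. A $$ (i, i))"

text \<open>The order on complex numbers is the one of \<^theory>\<open>HOL-Library.Complex_Order\<close>, so that
  \<^term>\<open>0 \<le> (z :: complex)\<close> says that \<^term>\<open>z\<close> is real and nonnegative.\<close>

definition positive_semidefinite :: "complex mat \<Rightarrow> bool" where
  "positive_semidefinite A \<longleftrightarrow>
     square_mat A \<and> mat_adjoint A = A \<and>
     (\<forall>v \<in> carrier_vec (dim_row A). 0 \<le> (A *\<^sub>v v) \<bullet>c v)"

definition DO :: "nat \<Rightarrow> complex mat set" where
  "DO n = {A \<in> carrier_mat n n. positive_semidefinite A \<and> mat_trace A = 1}"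

definition completely_mixed :: "nat \<Rightarrow> complex mat" where
  "completely_mixed n = (1 / of_nat n) \<cdot>\<^sub>m 1\<^sub>m n"

definition pure_state :: "complex vec \<Rightarrow> complex mat" where
  "pure_state v = mat (dim_vec v) (dim_vec v) (\<lambda>(i, j). v $ i * cnj (v $ j))"

text \<open>The eigenvalues of a state are real, so taking real parts loses nothing; see
  \<open>spectrum_DO_nonneg\<close> and \<open>highest_eigenvalue_DO\<close> below.\<close>

definition highest_eigenvalue :: "complex mat \<Rightarrow> real" where
  "highest_eigenvalue A = Max (Re ` spectrum A)"

text \<open>Matrices of size \<open>n * m\<close> are identified with the tensor product by the Kronecker
  product: the index \<open>i * m + k\<close> with \<open>i < n\<close>, \<open>k < m\<close> stands for \<open>e\<^sub>i \<otimes> e\<^sub>k\<close>.\<close>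

definition kron :: "complex mat \<Rightarrow> complex mat \<Rightarrow> complex mat" where
  "kron A B = mat (dim_row A * dim_row B) (dim_col A * dim_col B)
     (\<lambda>(i, j). A $$ (i div dim_row B, j div dim_col B) * B $$ (i mod dim_row B, j mod dim_col B))"

text \<open>Partial trace over the second factor. It is the unique linear map sending \<open>A \<otimes> B\<close> to
  \<open>tr(B) A\<close>; see \<open>partial_trace2_kron\<close> and \<open>partial_trace2_unique\<close>.\<close>

definition partial_trace2 :: "nat \<Rightarrow> nat \<Rightarrow> complex mat \<Rightarrow> complex mat" where
  "partial_trace2 n m A = mat n n (\<lambda>(i, j). \<Sum>k<m. A $$ (i * m + k, j * m + k))"

lemma kron_index_less: "i * m + k < n * m" if "i < n" "k < (m::nat)"
proof -
  have "i * m + k < Suc i * m" using that by simp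
  also have "\<dots> \<le> n * m" using that by (intro mult_right_mono) auto
  finally show ?thesis .
qed

lemma partial_trace2_carrier: "partial_trace2 n m A \<in> carrier_mat n n"
  by (simp add: partial_trace2_def)

lemma partial_trace2_kron:
  assumes "A \<in> carrier_mat n n" "B \<in> carrier_mat m m"
  shows "partial_trace2 n m (kron A B) = mat_trace B \<cdot>\<^sub>m A"
proof (rule eq_matI)
  fix i j assume "i < dim_row (mat_trace B \<cdot>\<^sub>m A)" "j < dim_col (mat_trace B \<cdot>\<^sub>m A)"
  then have ij: "i < n" "j < n" using assms by auto
  have "kron A B $$ (i * m + k, j * m + k) = A $$ (i, j) * B $$ (k, k)" if "k < m" for k
    using assms ij that by (simp add: kron_def kron_index_less)
  then show "partial_trace2 n m (kron A B) $$ (i, j) = (mat_trace B \<cdot>\<^sub>m A) $$ (i, j)"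
    using assms ij
    by (simp add: partial_trace2_def mat_trace_def sum_distrib_left mult.commute)
qed (use assms in \<open>auto simp: partial_trace2_def\<close>)

lemma partial_trace2_add:
  assumes "A \<in> carrier_mat (n * m) (n * m)" "B \<in> carrier_mat (n * m) (n * m)"
  shows "partial_trace2 n m (A + B) = partial_trace2 n m A + partial_trace2 n m B"
  using assms by (intro eq_matI) (auto simp: partial_trace2_def kron_index_less sum.distrib)

lemma partial_trace2_smult:
  assumes "A \<in> carrier_mat (n * m) (n * m)"
  shows "partial_trace2 n m (c \<cdot>\<^sub>m A) = c \<cdot>\<^sub>m partial_trace2 n m A"
  using assms by (intro eq_matI) (auto simp: partial_trace2_def kron_index_less sum_distrib_left)

lemma partial_trace2_unique:
  fixes T :: "complex mat \<Rightarrow> complex mat"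
  assumes add: "\<And>A B. A \<in> carrier_mat (n * m) (n * m) \<Longrightarrow> B \<in> carrier_mat (n * m) (n * m) \<Longrightarrow>
      T (A + B) = T A + T B"
    and smult: "\<And>c A. A \<in> carrier_mat (n * m) (n * m) \<Longrightarrow> T (c \<cdot>\<^sub>m A) = c \<cdot>\<^sub>m T A"
    and kron: "\<And>A B. A \<in> carrier_mat n n \<Longrightarrow> B \<in> carrier_mat m m \<Longrightarrow>
      T (kron A B) = mat_trace B \<cdot>\<^sub>m A"
    and A: "A \<in> carrier_mat (n * m) (n * m)"
  shows "T A = partial_trace2 n m A"
proof -
  define R where "R S = mat (n * m) (n * m) (\<lambda>p. if p \<in> S then A $$ p else 0)" for S
  define E where "E d p = mat d d (\<lambda>q. if q = p then 1 else 0 :: complex)" for d :: nat and p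
  have zero: "R {} = 0 \<cdot>\<^sub>m kron (0\<^sub>m n n) (0\<^sub>m m m)"
    by (intro eq_matI) (auto simp: R_def kron_def)
  have Kc: "kron X Y \<in> carrier_mat (n * m) (n * m)"
    if "X \<in> carrier_mat n n" "Y \<in> carrier_mat m m" for X Y
    using that by (simp add: kron_def)
  have Ec: "E d p \<in> carrier_mat d d" for d p by (simp add: E_def)
  have "T (R S) = partial_trace2 n m (R S)"
    if "finite S" "S \<subseteq> {..<n * m} \<times> {..<n * m}" for S
    using that
  proof (induction S rule: finite_induct)
    case empty
    show ?case unfolding zero
      by (simp add: smult kron Kc partial_trace2_smult partial_trace2_kron)
  next
    case (insert p S)
    obtain i j where p: "p = (i, j)" "i < n * m" "j < n * m" using insert.prems by auto
    have m: "m > 0" using p by (cases m) auto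
    let ?K = "kron (E n (i div m, j div m)) (E m (i mod m, j mod m))"
    have split: "a = b \<longleftrightarrow> a div m = b div m \<and> a mod m = b mod m" for a b :: nat
      by (metis div_mult_mod_eq)
    have K: "?K $$ (a, b) = (if (a, b) = p then 1 else 0)" if "a < n * m" "b < n * m" for a b
      using that m split[of a i] split[of b j]
      by (auto simp: kron_def E_def p(1) less_mult_imp_div_less)
    have Kd: "dim_row ?K = n * m" "dim_col ?K = n * m" by (simp_all add: kron_def E_def)
    have eq: "R (insert p S) = R S + (A $$ p) \<cdot>\<^sub>m ?K"
      using insert.hyps by (intro eq_matI) (auto simp: R_def K Kd)
    have Rc: "R S \<in> carrier_mat (n * m) (n * m)" by (simp add: R_def)
    show ?case unfolding eq using insert
      by (simp add: add smult kron Rc Kc Ec partial_trace2_add partial_trace2_smult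
          partial_trace2_kron)
  qed
  from this[of "{..<n * m} \<times> {..<n * m}"]
  have "T (R ({..<n * m} \<times> {..<n * m})) = partial_trace2 n m (R ({..<n * m} \<times> {..<n * m}))"
    by simp
  moreover have "R ({..<n * m} \<times> {..<n * m}) = A"
    using A by (intro eq_matI) (auto simp: R_def)
  ultimately show ?thesis by simp
qed

lemma sum_index_split:
  fixes f :: "nat \<Rightarrow> 'a :: comm_monoid_add"
  shows "(\<Sum>p<n * m. f p) = (\<Sum>i<n. \<Sum>k<m. f (i * m + k))"
proof (induction n)
  case (Suc n)
  have "(\<Sum>p<Suc n * m. f p) = (\<Sum>p<n * m. f p) + (\<Sum>p=n * m..<n * m + m. f p)"
    by (simp add: lessThan_atLeast0 sum.atLeastLessThan_concat add.commute)
  also have "(\<Sum>p=n * m..<n * m + m. f p) = (\<Sum>k<m. f (n * m + k))"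
    using sum.shift_bounds_nat_ivl[of f 0 "n * m" m]
    by (simp add: lessThan_atLeast0 add.commute)
  finally show ?case using Suc by simp
qed simp

lemma mat_adjoint_eq_iff:
  assumes "A \<in> carrier_mat n n"
  shows "mat_adjoint A = A \<longleftrightarrow> (\<forall>i<n. \<forall>j<n. cnj (A $$ (j, i)) = A $$ (i, j))"
proof -
  have "mat_adjoint A = mat n n (\<lambda>(i, j). cnj (A $$ (j, i)))"
    using assms by (intro eq_matI) (auto simp: mat_adjoint_def mat_of_rows_def)
  then show ?thesis using assms by (auto simp: mat_eq_iff)
qed

lemma quadratic_form_sum:
  assumes "A \<in> carrier_mat n n" "v \<in> carrier_vec n"
  shows "(A *\<^sub>v v) \<bullet>c v = (\<Sum>i<n. \<Sum>j<n. A $$ (i, j) * v $ j * cnj (v $ i))"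
  using assms
  by (simp add: scalar_prod_def sum_distrib_right lessThan_atLeast0)

lemma partial_trace2_DO:
  assumes "A \<in> DO (n * m)"
  shows "partial_trace2 n m A \<in> DO n"
proof -
  let ?T = "partial_trace2 n m A"
  have A: "A \<in> carrier_mat (n * m) (n * m)" "mat_adjoint A = A" "mat_trace A = 1"
    and pos: "\<And>v. v \<in> carrier_vec (n * m) \<Longrightarrow> 0 \<le> (A *\<^sub>v v) \<bullet>c v"
    using assms by (auto simp: DO_def positive_semidefinite_def)
  have T: "?T \<in> carrier_mat n n" by (rule partial_trace2_carrier)
  have adj: "mat_adjoint ?T = ?T"
    using A unfolding mat_adjoint_eq_iff[OF T] mat_adjoint_eq_iff[OF A(1)]
    by (simp add: partial_trace2_def kron_index_less)
  have tr: "mat_trace ?T = 1"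
    using A by (simp add: mat_trace_def partial_trace2_def sum_index_split)
  have "0 \<le> (?T *\<^sub>v v) \<bullet>c v" if v: "v \<in> carrier_vec n" for v
  proof -
    define w where "w k = vec (n * m) (\<lambda>p. if p mod m = k then v $ (p div m) else 0)" for k
    have w: "w k $ (i * m + l) = (if l = k then v $ i else 0)" if "i < n" "l < m" for k i l
      using that by (simp add: w_def kron_index_less)
    have "(A *\<^sub>v w k) \<bullet>c w k
        = (\<Sum>i<n. \<Sum>j<n. A $$ (i * m + k, j * m + k) * v $ j * cnj (v $ i))" if k: "k < m" for k
    proof -
      have "(A *\<^sub>v w k) \<bullet>c w k = (\<Sum>p<n * m. \<Sum>q<n * m. A $$ (p, q) * w k $ q * cnj (w k $ p))"
        by (rule quadratic_form_sum) (use A in \<open>auto simp: w_def\<close>)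
      also have "\<dots> = (\<Sum>i<n. \<Sum>a<m. \<Sum>j<n. \<Sum>b<m.
          A $$ (i * m + a, j * m + b) * w k $ (j * m + b) * cnj (w k $ (i * m + a)))"
        by (simp only: sum_index_split)
      also have "\<dots> = (\<Sum>i<n. \<Sum>a<m. if a = k then
          \<Sum>j<n. \<Sum>b<m. if b = k then A $$ (i * m + a, j * m + b) * v $ j * cnj (v $ i) else 0 else 0)"
      proof (intro sum.cong refl)
        fix i a assume "i \<in> {..<n}" "a \<in> {..<m}"
        then show "(\<Sum>j<n. \<Sum>b<m. A $$ (i * m + a, j * m + b) * w k $ (j * m + b) * cnj (w k $ (i * m + a)))
          = (if a = k then \<Sum>j<n. \<Sum>b<m. if b = k then A $$ (i * m + a, j * m + b) * v $ j * cnj (v $ i) else 0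
             else 0)"
          by (cases "a = k") (simp_all only: w if_True if_False lessThan_iff simp_thms,
            (intro sum.cong refl, simp add: w), simp)
      qed
      also have "\<dots> = (\<Sum>i<n. \<Sum>j<n. A $$ (i * m + k, j * m + k) * v $ j * cnj (v $ i))"
        using k by simp
      finally show ?thesis .
    qed
    then have "(\<Sum>k<m. (A *\<^sub>v w k) \<bullet>c w k)
        = (\<Sum>k<m. \<Sum>i<n. \<Sum>j<n. A $$ (i * m + k, j * m + k) * v $ j * cnj (v $ i))"
      by simp
    also have "\<dots> = (\<Sum>i<n. \<Sum>j<n. \<Sum>k<m. A $$ (i * m + k, j * m + k) * v $ j * cnj (v $ i))"
      by (subst sum.swap, rule sum.cong[OF refl], rule sum.swap)
    also have "\<dots> = (?T *\<^sub>v v) \<bullet>c v"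
      by (subst quadratic_form_sum[OF T v]) (simp add: partial_trace2_def sum_distrib_right)
    finally have "(?T *\<^sub>v v) \<bullet>c v = (\<Sum>k<m. (A *\<^sub>v w k) \<bullet>c w k)" ..
    moreover have "0 \<le> (\<Sum>k<m. (A *\<^sub>v w k) \<bullet>c w k)"
      by (intro sum_nonneg pos) (simp add: w_def)
    ultimately show ?thesis by simp
  qed
  then show ?thesis using T adj tr by (simp add: DO_def positive_semidefinite_def)
qed

lemma spectrum_DO_nonneg:
  assumes "\<rho> \<in> DO n" "k \<in> spectrum \<rho>"
  shows "0 \<le> k"
proof -
  have \<rho>: "\<rho> \<in> carrier_mat n n" using assms by (simp add: DO_def)
  obtain v where v: "v \<in> carrier_vec n" "v \<noteq> 0\<^sub>v n" "\<rho> *\<^sub>v v = k \<cdot>\<^sub>v v"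
    using assms(2) \<rho> by (auto simp: spectrum_def eigenvalue_def eigenvector_def)
  have "0 \<le> (\<rho> *\<^sub>v v) \<bullet>c v"
    using assms(1) v \<rho> by (auto simp: DO_def positive_semidefinite_def)
  then have "0 \<le> k * (v \<bullet>c v)" using v by simp
  moreover have "v \<bullet>c v > 0" using v by (simp add: conjugate_square_greater_0_vec)
  ultimately show ?thesis
    by (auto simp: less_eq_complex_def less_complex_def zero_le_mult_iff)
qed

lemma highest_eigenvalue_DO:
  assumes "\<rho> \<in> DO n" "n > 0"
  shows "eigenvalue \<rho> (complex_of_real (highest_eigenvalue \<rho>))"
    and "eigenvalue \<rho> k \<Longrightarrow> k \<le> complex_of_real (highest_eigenvalue \<rho>)"
proof -
  have \<rho>: "\<rho> \<in> carrier_mat n n" using assms by (simp add: DO_def)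
  have fin: "finite (Re ` spectrum \<rho>)" using card_finite_spectrum(1)[OF \<rho>] by simp
  have ne: "Re ` spectrum \<rho> \<noteq> {}" using spectrum_non_empty[OF \<rho> assms(2)] by simp
  obtain l where l: "l \<in> spectrum \<rho>" "highest_eigenvalue \<rho> = Re l"
    using Max_in[OF fin ne] by (auto simp: highest_eigenvalue_def)
  have "complex_of_real (Re l) = l"
    using spectrum_DO_nonneg[OF assms(1) l(1)] by (auto simp: less_eq_complex_def complex_eq_iff)
  then show "eigenvalue \<rho> (complex_of_real (highest_eigenvalue \<rho>))"
    using l by (simp add: spectrum_def)
  assume "eigenvalue \<rho> k"
  then have k: "k \<in> spectrum \<rho>" by (simp add: spectrum_def)
  then have "Re k \<le> highest_eigenvalue \<rho>"
    using Max_ge[OF fin] by (simp add: highest_eigenvalue_def)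
  then show "k \<le> complex_of_real (highest_eigenvalue \<rho>)"
    using spectrum_DO_nonneg[OF assms(1) k] by (auto simp: less_eq_complex_def)
qed

end

theory Submission
  imports Defs
begin

text \<open>Write \<open>[s, t]\<close> for the diagonal state of \<open>DO n\<close> with entries \<open>s, t\<close> at the positions
  \<open>p \<noteq> q\<close> and zeros elsewhere. The unit vector
  \<open>v = 4/5 e\<^sub>p \<otimes> e\<^sub>p + 3/5 e\<^sub>q \<otimes> e\<^sub>q\<close> has reduced state \<open>[16/25, 9/25]\<close>, and it spans the top
  eigenspace of \<open>\<rho> = 9/16 |v\<rangle>\<langle>v| + 7/16 |e\<^sub>q \<otimes> e\<^sub>p\<rangle>\<langle>e\<^sub>q \<otimes> e\<^sub>p|\<close>, whose reduced state is
  \<open>[9/25, 16/25]\<close>. Monotonicity would therefore give \<open>[9/25, 16/25] \<le>' [16/25, 9/25]\<close>, and also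
  the converse after exchanging \<open>p\<close> and \<open>q\<close>, against antisymmetry. A maximally entangled \<open>v\<close>, with
  reduced state \<open>\<bottom>\<^sub>n\<close>, would be available only for \<open>n \<le> m\<close>.\<close>

lemma pure_state_carrier: "v \<in> carrier_vec d \<Longrightarrow> pure_state v \<in> carrier_mat d d"
  by (auto simp: pure_state_def)

lemma smult_mat_mult_vec:
  fixes c :: "'a :: comm_ring_1"
  assumes "A \<in> carrier_mat nr nc" "x \<in> carrier_vec nc"
  shows "(c \<cdot>\<^sub>m A) *\<^sub>v x = c \<cdot>\<^sub>v (A *\<^sub>v x)"
  using assms by (intro eq_vecI) (auto simp: scalar_prod_def sum_distrib_left mult_ac)

lemma pure_state_mult_vec:
  assumes "v \<in> carrier_vec d" "x \<in> carrier_vec d"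
  shows "pure_state v *\<^sub>v x = (x \<bullet>c v) \<cdot>\<^sub>v v"
proof (rule eq_vecI)
  fix i assume "i < dim_vec ((x \<bullet>c v) \<cdot>\<^sub>v v)"
  then show "(pure_state v *\<^sub>v x) $ i = ((x \<bullet>c v) \<cdot>\<^sub>v v) $ i"
    using assms by (auto simp: pure_state_def scalar_prod_def sum_distrib_left mult_ac)
qed (use assms in \<open>auto simp: pure_state_def\<close>)

lemma mat_trace_pure_state: "mat_trace (pure_state v) = v \<bullet>c v"
  by (simp add: mat_trace_def pure_state_def scalar_prod_def lessThan_atLeast0)

text \<open>Positivity holds because the quadratic form at \<open>x\<close> is the squared modulus
  of \<open>x \<bullet>c v\<close>; the normalisation of \<open>v\<close> gives trace one.\<close>

lemma pure_state_DO:
  assumes v: "v \<in> carrier_vec d" and "v \<bullet>c v = 1"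
  shows "pure_state v \<in> DO d"
proof -
  have P: "pure_state v \<in> carrier_mat d d" using v by (rule pure_state_carrier)
  have "mat_adjoint (pure_state v) = pure_state v"
    unfolding mat_adjoint_eq_iff[OF P] using v by (auto simp: pure_state_def)
  moreover have "0 \<le> (pure_state v *\<^sub>v x) \<bullet>c x" if x: "x \<in> carrier_vec d" for x
  proof -
    have "v \<bullet>c x = cnj (x \<bullet>c v)"
      using conjugate_vec_sprod_comm[OF v x] conjugate_conjugate_sprod[OF x v]
        conjugate_sprod_vec[of x d "conjugate v"] v x
      by (simp add: comm_scalar_prod[of _ d])
    then have "(pure_state v *\<^sub>v x) \<bullet>c x = (x \<bullet>c v) * cnj (x \<bullet>c v)"
      using v x by (simp add: pure_state_mult_vec)
    then show ?thesis by (simp add: complex_mult_cnj less_eq_complex_def)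
  qed
  ultimately show ?thesis
    using P assms by (auto simp: DO_def positive_semidefinite_def mat_trace_pure_state)
qed

lemma DO_convex:
  assumes A: "A \<in> DO d" and B: "B \<in> DO d" and ab: "0 \<le> a" "0 \<le> b" "a + b = (1::real)"
  shows "complex_of_real a \<cdot>\<^sub>m A + complex_of_real b \<cdot>\<^sub>m B \<in> DO d"
proof -
  let ?M = "complex_of_real a \<cdot>\<^sub>m A + complex_of_real b \<cdot>\<^sub>m B"
  have Ac: "A \<in> carrier_mat d d" and Bc: "B \<in> carrier_mat d d" using A B by (auto simp: DO_def)
  then have M: "?M \<in> carrier_mat d d" by simp
  have "mat_adjoint A = A" "mat_adjoint B = B"
    using A B by (auto simp: DO_def positive_semidefinite_def)
  then have "mat_adjoint ?M = ?M"
    using Ac Bc unfolding mat_adjoint_eq_iff[OF M] mat_adjoint_eq_iff[OF Ac] mat_adjoint_eq_iff[OF Bc]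
    by simp
  moreover have "mat_trace ?M = a * mat_trace A + b * mat_trace B"
    using Ac Bc by (simp add: mat_trace_def sum.distrib sum_distrib_left)
  then have "mat_trace ?M = complex_of_real (a + b)"
    using A B by (simp add: DO_def)
  then have "mat_trace ?M = 1" using ab by simp
  moreover have "0 \<le> (?M *\<^sub>v x) \<bullet>c x" if x: "x \<in> carrier_vec d" for x
  proof -
    have "(?M *\<^sub>v x) \<bullet>c x = a * ((A *\<^sub>v x) \<bullet>c x) + b * ((B *\<^sub>v x) \<bullet>c x)"
      using Ac Bc x
      by (simp add: quadratic_form_sum[OF M x] quadratic_form_sum[OF Ac x] quadratic_form_sum[OF Bc x]
          sum.distrib sum_distrib_left algebra_simps)
    moreover have "0 \<le> (A *\<^sub>v x) \<bullet>c x" "0 \<le> (B *\<^sub>v x) \<bullet>c x"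
      using A B x by (auto simp: DO_def positive_semidefinite_def)
    ultimately show ?thesis using ab by (simp add: less_eq_complex_def)
  qed
  ultimately show ?thesis using M Ac Bc by (auto simp: DO_def positive_semidefinite_def)
qed

text \<open>For orthonormal \<open>v\<close> and \<open>w\<close> the sum is already a spectral
  decomposition: every eigenvalue is one of \<open>a\<close>, \<open>b\<close> and \<open>0\<close>,
  and \<open>0 \<le> b \<le> a\<close> makes \<open>a\<close> the largest.\<close>

lemma highest_eigenvector_mixture:
  assumes v: "v \<in> carrier_vec d" and w: "w \<in> carrier_vec d"
    and vv: "v \<bullet>c v = 1" and ww: "w \<bullet>c w = 1" and vw: "v \<bullet>c w = 0" and wv: "w \<bullet>c v = 0"
    and ab: "0 \<le> b" "b \<le> (a::real)"
  defines "\<rho> \<equiv> complex_of_real a \<cdot>\<^sub>m pure_state v + complex_of_real b \<cdot>\<^sub>m pure_state w"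
  shows "eigenvector \<rho> v (complex_of_real (highest_eigenvalue \<rho>))"
proof -
  have P: "pure_state v \<in> carrier_mat d d" "pure_state w \<in> carrier_mat d d"
    using v w by (auto intro: pure_state_carrier)
  then have \<rho>: "\<rho> \<in> carrier_mat d d" by (simp add: \<rho>_def)
  have mult: "\<rho> *\<^sub>v x = (a * (x \<bullet>c v)) \<cdot>\<^sub>v v + (b * (x \<bullet>c w)) \<cdot>\<^sub>v w" if "x \<in> carrier_vec d" for x
  proof -
    have "\<rho> *\<^sub>v x = a \<cdot>\<^sub>v (pure_state v *\<^sub>v x) + b \<cdot>\<^sub>v (pure_state w *\<^sub>v x)"
      unfolding \<rho>_def using P that by (simp add: add_mult_distrib_mat_vec[of _ d d] smult_mat_mult_vec[of _ d d])
    then show ?thesis using v w that by (simp add: pure_state_mult_vec smult_smult_assoc)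
  qed
  have "v \<noteq> 0\<^sub>v d" using vv by auto
  moreover have "\<rho> *\<^sub>v v = a \<cdot>\<^sub>v v"
    unfolding mult[OF v] vv vw using v w by (intro eq_vecI) auto
  ultimately have ev: "eigenvector \<rho> v a"
    using v \<rho> by (auto simp: eigenvector_def)
  have "Re k \<le> a" if k: "k \<in> spectrum \<rho>" for k
  proof -
    obtain x where x: "x \<in> carrier_vec d" "x \<noteq> 0\<^sub>v d" "\<rho> *\<^sub>v x = k \<cdot>\<^sub>v x"
      using k \<rho> by (auto simp: spectrum_def eigenvalue_def eigenvector_def)
    \<comment> \<open>Pairing the eigenvalue equation with \<open>v\<close>, \<open>w\<close> and
      \<open>x\<close> in turn treats the three cases: \<open>x\<close> not orthogonal to
      \<open>v\<close>, not orthogonal to \<open>w\<close>, orthogonal to both.\<close>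
    have 1: "k * (x \<bullet>c u) = a * (x \<bullet>c v) * (v \<bullet>c u) + b * (x \<bullet>c w) * (w \<bullet>c u)"
      if u: "u \<in> carrier_vec d" for u
    proof -
      have "k * (x \<bullet>c u) = (\<rho> *\<^sub>v x) \<bullet>c u" using x u by simp
      also have "\<dots> = a * (x \<bullet>c v) * (v \<bullet>c u) + b * (x \<bullet>c w) * (w \<bullet>c u)"
        using v w u x(1) by (simp add: mult add_scalar_prod_distrib[of _ d])
      finally show ?thesis .
    qed
    have "k = a" if "x \<bullet>c v \<noteq> 0" using 1[OF v] that by (simp add: vv wv)
    moreover have "k = b" if "x \<bullet>c w \<noteq> 0" using 1[OF w] that by (simp add: ww vw)
    moreover have "k = 0" if "x \<bullet>c v = 0" "x \<bullet>c w = 0"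
      using 1[OF x(1)] that x(1,2) by simp
    ultimately show ?thesis using ab by (metis Re_complex_of_real zero_complex.simps(1) order.trans order.refl)
  qed
  moreover have "complex_of_real a \<in> spectrum \<rho>"
    using ev by (auto simp: spectrum_def eigenvalue_def)
  then have "a \<in> Re ` spectrum \<rho>" by force
  ultimately have "highest_eigenvalue \<rho> = a"
    unfolding highest_eigenvalue_def
    using card_finite_spectrum(1)[OF \<rho>] by (intro Max_eqI) auto
  then show ?thesis using ev by simp
qed

text \<open>With \<open>v\<close> reshaped into an \<open>n\<close> by \<open>m\<close> coefficient
  matrix, the right-hand side is that matrix times its adjoint.\<close>

lemma partial_trace2_pure_state:
  assumes "v \<in> carrier_vec (n * m)"
  shows "partial_trace2 n m (pure_state v) =
    mat n n (\<lambda>(i, j). \<Sum>k<m. v $ (i * m + k) * cnj (v $ (j * m + k)))"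
  using assms by (intro eq_matI) (auto simp: partial_trace2_def pure_state_def kron_index_less)

lemma cscalar_prod_split:
  fixes v w :: "complex vec"
  assumes "v \<in> carrier_vec (n * m)" "w \<in> carrier_vec (n * m)"
  shows "v \<bullet>c w = (\<Sum>i<n. \<Sum>k<m. v $ (i * m + k) * cnj (w $ (i * m + k)))"
  using assms by (simp add: scalar_prod_def lessThan_atLeast0[symmetric] sum_index_split kron_index_less)

text \<open>For \<open>p \<noteq> q\<close> this is \<open>[16/25, 9/25]\<close>; exchanging the
  arguments \<open>p\<close> and \<open>q\<close> gives \<open>[9/25, 16/25]\<close>, so one family
  covers both reduced states.\<close>

definition two_point_state :: "nat \<Rightarrow> nat \<Rightarrow> nat \<Rightarrow> complex mat" where
  "two_point_state n p q =
     mat n n (\<lambda>(i, j). if i = j then if i = p then 16/25 else if i = q then 9/25 else 0 else 0)"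

text \<open>General \<open>p\<close> and \<open>q\<close> let the construction be reused with the
  two exchanged. Both must index either factor, since \<open>v\<close> involves
  \<open>e\<^sub>p \<otimes> e\<^sub>p\<close> and
  \<open>e\<^sub>q \<otimes> e\<^sub>q\<close>.\<close>

lemma mixture_below_pure_state:
  assumes "p < n" "p < m" "q < n" "q < m" "p \<noteq> q"
  obtains \<rho> v where "\<rho> \<in> DO (n * m)" "v \<in> carrier_vec (n * m)" "v \<bullet>c v = 1"
    "eigenvector \<rho> v (complex_of_real (highest_eigenvalue \<rho>))"
    "partial_trace2 n m \<rho> = two_point_state n q p"
    "partial_trace2 n m (pure_state v) = two_point_state n p q"
proof -
  define v :: "complex vec" where "v = vec (n * m) (\<lambda>r. if r div m = r mod m then
    if r mod m = p then 4/5 else if r mod m = q then 3/5 else 0 else 0)"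
  \<comment> \<open>\<open>w\<close> is \<open>e\<^sub>q \<otimes> e\<^sub>p\<close>: its support is
    disjoint from that of \<open>v\<close>, and its reduced state is concentrated at
    \<open>q\<close>.\<close>
  define w :: "complex vec" where "w = vec (n * m) (\<lambda>r. if r div m = q \<and> r mod m = p then 1 else 0)"
  have v: "v \<in> carrier_vec (n * m)" and w: "w \<in> carrier_vec (n * m)" by (auto simp: v_def w_def)
  \<comment> \<open>The test on \<open>k\<close> stands outermost so that sums over the second
    factor collapse to one term.\<close>
  have vi: "v $ (i * m + k) = (if k = i then if i = p then 4/5 else if i = q then 3/5 else 0 else 0)"
    and wi: "w $ (i * m + k) = (if k = p then if i = q then 1 else 0 else 0)"
    if "i < n" "k < m" for i k
    using that by (auto simp: v_def w_def kron_index_less)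
  have tv: "partial_trace2 n m (pure_state v) = two_point_state n p q"
    unfolding partial_trace2_pure_state[OF v] two_point_state_def
    using assms by (intro eq_matI) (auto simp: vi if_distrib[of cnj] if_distrib[of "\<lambda>x. _ * x"]
        if_distrib[of "\<lambda>x. x * _"] cong: if_cong)
  have tw: "partial_trace2 n m (pure_state w) = mat n n (\<lambda>(i, j). if i = q \<and> j = q then 1 else 0)"
    unfolding partial_trace2_pure_state[OF w]
    using assms by (intro eq_matI) (auto simp: wi if_distrib[of cnj] if_distrib[of "\<lambda>x. _ * x"]
        if_distrib[of "\<lambda>x. x * _"] cong: if_cong)
  have vv: "v \<bullet>c v = 1"
  proof -
    \<comment> \<open>As \<open>p \<noteq> q\<close>, the nested conditional splits into two
      summands, each of which collapses separately.\<close>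
    have "v \<bullet>c v = (\<Sum>i<n. (if i = p then 16/25 else 0) + (if i = q then 9/25 else 0))"
      unfolding cscalar_prod_split[OF v v]
    proof (intro sum.cong refl)
      fix i assume "i \<in> {..<n}"
      then have "(\<Sum>k<m. v $ (i * m + k) * cnj (v $ (i * m + k)))
        = (\<Sum>k<m. if k = i then if i = p then 16/25 else if i = q then 9/25 else 0 else 0)"
        by (intro sum.cong) (auto simp: vi)
      then show "(\<Sum>k<m. v $ (i * m + k) * cnj (v $ (i * m + k)))
        = (if i = p then 16/25 else 0) + (if i = q then 9/25 else 0)"
        using assms by simp
    qed
    then show ?thesis using assms by (simp add: sum.distrib)
  qed
  have ww: "w \<bullet>c w = 1"
  proof -
    have "w \<bullet>c w = (\<Sum>i<n. \<Sum>k<m. if k = p then if i = q then 1 else 0 else 0)"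
      unfolding cscalar_prod_split[OF w w] by (intro sum.cong refl) (auto simp: wi)
    then show ?thesis using assms by simp
  qed
  have vw: "v \<bullet>c w = 0"
    unfolding cscalar_prod_split[OF v w] using assms by (intro sum.neutral ballI) (auto simp: vi wi)
  have wv: "w \<bullet>c v = 0"
    unfolding cscalar_prod_split[OF w v] using assms by (intro sum.neutral ballI) (auto simp: vi wi)
  \<comment> \<open>The weight 9/16 scales the entry 16/25 at \<open>p\<close> down to 9/25; the
    entry at \<open>q\<close> becomes 9/16 * 9/25 + 7/16 = 16/25. Since 9/16 exceeds 7/16,
    \<open>v\<close> belongs to the highest eigenvalue.\<close>
  define \<rho> where "\<rho> = complex_of_real (9/16) \<cdot>\<^sub>m pure_state v + complex_of_real (7/16) \<cdot>\<^sub>m pure_state w"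
  have "\<rho> \<in> DO (n * m)"
    unfolding \<rho>_def by (intro DO_convex pure_state_DO v w vv ww) auto
  moreover have "eigenvector \<rho> v (complex_of_real (highest_eigenvalue \<rho>))"
    unfolding \<rho>_def by (rule highest_eigenvector_mixture[OF v w vv ww vw wv]) auto
  moreover have "partial_trace2 n m \<rho> = two_point_state n q p"
  proof -
    have "partial_trace2 n m \<rho> = complex_of_real (9/16) \<cdot>\<^sub>m partial_trace2 n m (pure_state v)
        + complex_of_real (7/16) \<cdot>\<^sub>m partial_trace2 n m (pure_state w)"
      unfolding \<rho>_def using pure_state_carrier[OF v] pure_state_carrier[OF w]
      by (simp add: partial_trace2_add partial_trace2_smult)
    also have "\<dots> = two_point_state n q p"
      unfolding tv tw two_point_state_def using assms by (intro eq_matI) auto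
    finally show ?thesis .
  qed
  ultimately show ?thesis using that v vv tv by blast
qed

theorem lemma7:
  fixes n m :: nat
    and le le' :: "complex mat rel"
  assumes "n \<ge> 2" and "m \<ge> 2"
    and "partial_order_on (DO (n * m)) le"
    and "\<And>\<rho> v. \<rho> \<in> DO (n * m) \<Longrightarrow>
           eigenvector \<rho> v (complex_of_real (highest_eigenvalue \<rho>)) \<Longrightarrow> v \<bullet>c v = 1 \<Longrightarrow>
           (\<rho>, pure_state v) \<in> le"
    and "partial_order_on (DO n) le'"
    and "\<And>\<sigma>. \<sigma> \<in> DO n \<Longrightarrow> (completely_mixed n, \<sigma>) \<in> le'"
  shows "\<not> monotone_on (DO (n * m)) (\<lambda>\<rho> \<sigma>. (\<rho>, \<sigma>) \<in> le) (\<lambda>\<rho> \<sigma>. (\<rho>, \<sigma>) \<in> le')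
             (partial_trace2 n m)"
proof
  assume mono: "monotone_on (DO (n * m)) (\<lambda>\<rho> \<sigma>. (\<rho>, \<sigma>) \<in> le) (\<lambda>\<rho> \<sigma>. (\<rho>, \<sigma>) \<in> le')
    (partial_trace2 n m)"
  \<comment> \<open>Positions 0 and 1 exist in both factors because \<open>n\<close> and
    \<open>m\<close> are at least 2.\<close>
  have below: "(two_point_state n q p, two_point_state n p q) \<in> le'"
    if pq: "p < 2" "q < 2" "p \<noteq> q" for p q
  proof -
    have "p < n" "p < m" "q < n" "q < m" using pq assms(1,2) by auto
    then obtain \<rho> v where \<rho>: "\<rho> \<in> DO (n * m)" and v: "v \<in> carrier_vec (n * m)" "v \<bullet>c v = 1"
      and ev: "eigenvector \<rho> v (complex_of_real (highest_eigenvalue \<rho>))"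
      and tr: "partial_trace2 n m \<rho> = two_point_state n q p"
        "partial_trace2 n m (pure_state v) = two_point_state n p q"
      using pq(3) by (rule mixture_below_pure_state)
    have "(\<rho>, pure_state v) \<in> le" using \<rho> ev v(2) by (rule assms(4))
    then show ?thesis
      using monotone_onD[OF mono \<rho> pure_state_DO[OF v]] by (simp add: tr)
  qed
  have "antisym le'" using assms(5) by (simp add: partial_order_on_def)
  then have "two_point_state n 0 1 = two_point_state n 1 0"
    using below[of 0 1] below[of 1 0] by (auto dest: antisymD)
  \<comment> \<open>The corner entries are 16/25 on the left and 9/25 on the right.\<close>
  then have "two_point_state n 0 1 $$ (0, 0) = two_point_state n 1 0 $$ (0, 0)" by simp
  then show False using assms(1) by (simp add: two_point_state_def)
qed

end
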